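(* Assume that $T_\psi$ is transitive. Let $f : \Sigma^+ \to \mathbb R$ be Hölder continuous. If $G$ is amenable then \[ P_{\mathrm{Gur}}(f,T_\psi) = P_{\mathrm{Gur}}(f,T_{\psi^{\mathrm{ab}}}) . \]
   Context: Let $\sigma:\Sigma^+\to\Sigma^+$ be a topologically mixing one-sided subshift of finite type, $G$ a countable group with identity $e$, and $\psi:\Sigma^+\to G$ depending only on two coordinates, $\psi(x)=\psi(x_0,x_1)$. The skew product is $T_\psi:\Sigma^+\times G\to\Sigma^+\times G$, $T_\psi(x,g)=(\sigma x,g\psi(x))$, with $\psi^n(x)=\psi(x)\psi(\sigma x)\cdots\psi(\sigma^{n-1}x)$. Let $G^{\mathrm{ab}}=G/[G,G]$, $\pi:G\to G^{\mathrm{ab}}$ the projection, $\psi^{\mathrm{ab}}=\pi\circ\psi$, and $T_{\psi^{\mathrm{ab}}}$ the induced $G^{\mathrm{ab}}$-extension. The function $f$ is also regarded as a function on $\Sigma^+\times G$ and $\Sigma^+\times G^{\mathrm{ab}}$ via $f(x,g)=f(x)$. The Gurevič pressure of $f$ for the extension is $P_{\mathrm{Gur}}(f,T_\psi)=\limsup_{n\to\infty}\frac1n\log\sum_{\sigma^nx=x,\ \psi^n(x)=e}e^{f^n(x)}$, where $f^n=f+f\circ\sigma+\dots+f\circ\sigma^{n-1}$, and analogously for $T_{\psi^{\mathrm{ab}}}$ (with the identity of $G^{\mathrm{ab}}$). *)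

theory Defs
  imports "HOL-Analysis.Analysis" "HOL-Algebra.Algebra"
begin

definition sft :: "('a \<Rightarrow> 'a \<Rightarrow> bool) \<Rightarrow> (nat \<Rightarrow> 'a) set" where
  "sft A = {x. \<forall>n. A (x n) (x (Suc n))}"

definition shiftn :: "nat \<Rightarrow> (nat \<Rightarrow> 'a) \<Rightarrow> (nat \<Rightarrow> 'a)" where
  "shiftn n x = (\<lambda>i. x (i + n))"

definition cyl :: "('a \<Rightarrow> 'a \<Rightarrow> bool) \<Rightarrow> 'a list \<Rightarrow> (nat \<Rightarrow> 'a) set" where
  "cyl A w = {x \<in> sft A. \<forall>i < length w. x i = w ! i}"

text \<open>Topological mixing, stated on the basis of cylinder sets of the product topology:
  for all nonempty cylinders U, V there is N with sigma^(-n) U meeting V for all n >= N.\<close>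
definition top_mixing :: "('a \<Rightarrow> 'a \<Rightarrow> bool) \<Rightarrow> bool" where
  "top_mixing A \<longleftrightarrow> (\<forall>u v. cyl A u \<noteq> {} \<longrightarrow> cyl A v \<noteq> {} \<longrightarrow>
      (\<exists>N. \<forall>n \<ge> N. \<exists>x \<in> cyl A v. shiftn n x \<in> cyl A u))"

definition sdist :: "(nat \<Rightarrow> 'a) \<Rightarrow> (nat \<Rightarrow> 'a) \<Rightarrow> real" where
  "sdist x y = (if x = y then 0 else (1/2) ^ (LEAST n. x n \<noteq> y n))"

definition holder_cont :: "('a \<Rightarrow> 'a \<Rightarrow> bool) \<Rightarrow> ((nat \<Rightarrow> 'a) \<Rightarrow> real) \<Rightarrow> bool" where
  "holder_cont A f \<longleftrightarrow> (\<exists>C \<alpha>. \<alpha> > 0 \<and>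
      (\<forall>x \<in> sft A. \<forall>y \<in> sft A. \<bar>f x - f y\<bar> \<le> C * sdist x y powr \<alpha>))"

definition birkhoff :: "((nat \<Rightarrow> 'a) \<Rightarrow> real) \<Rightarrow> nat \<Rightarrow> (nat \<Rightarrow> 'a) \<Rightarrow> real" where
  "birkhoff f n x = (\<Sum>k<n. f (shiftn k x))"

fun cocycle :: "('g, 'b) monoid_scheme \<Rightarrow> ((nat \<Rightarrow> 'a) \<Rightarrow> 'g) \<Rightarrow> nat \<Rightarrow> (nat \<Rightarrow> 'a) \<Rightarrow> 'g" where
  "cocycle G psi 0 x = \<one>\<^bsub>G\<^esub>"
| "cocycle G psi (Suc n) x = psi x \<otimes>\<^bsub>G\<^esub> cocycle G psi n (shiftn 1 x)"

text \<open>Topological transitivity of T_psi(x,g) = (sigma x, g psi(x)) on Sigma^+ x G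
  (G discrete), stated on the basis of open sets [u] x {g}.\<close>
definition skew_transitive ::
  "('a \<Rightarrow> 'a \<Rightarrow> bool) \<Rightarrow> ('g, 'b) monoid_scheme \<Rightarrow> ((nat \<Rightarrow> 'a) \<Rightarrow> 'g) \<Rightarrow> bool" where
  "skew_transitive A G psi \<longleftrightarrow> (\<forall>u v g h. cyl A u \<noteq> {} \<longrightarrow> cyl A v \<noteq> {} \<longrightarrow>
      g \<in> carrier G \<longrightarrow> h \<in> carrier G \<longrightarrow>
      (\<exists>n \<ge> 1. \<exists>x \<in> cyl A v. shiftn n x \<in> cyl A u \<and> g \<otimes>\<^bsub>G\<^esub> cocycle G psi n x = h))"

definition amenable :: "('g, 'b) monoid_scheme \<Rightarrow> bool" where
  "amenable G \<longleftrightarrow> (\<forall>K \<epsilon>. finite K \<longrightarrow> K \<subseteq> carrier G \<longrightarrow> (\<epsilon>::real) > 0 \<longrightarrow>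
      (\<exists>F. finite F \<and> F \<subseteq> carrier G \<and> F \<noteq> {} \<and>
         (\<forall>g \<in> K. real (card (((\<lambda>h. g \<otimes>\<^bsub>G\<^esub> h) ` F - F) \<union> (F - (\<lambda>h. g \<otimes>\<^bsub>G\<^esub> h) ` F)))
                     < \<epsilon> * real (card F))))"

definition gurevic_pressure ::
  "('a \<Rightarrow> 'a \<Rightarrow> bool) \<Rightarrow> ('g, 'b) monoid_scheme \<Rightarrow> ((nat \<Rightarrow> 'a) \<Rightarrow> 'g)
     \<Rightarrow> ((nat \<Rightarrow> 'a) \<Rightarrow> real) \<Rightarrow> ereal" where
  "gurevic_pressure A G psi f = limsup (\<lambda>n.
      let Z = (\<Sum>x \<in> {x \<in> sft A. shiftn n x = x \<and> cocycle G psi n x = \<one>\<^bsub>G\<^esub>}.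
                 exp (birkhoff f n x))
      in if Z = 0 then (-\<infinity>) else ereal (ln Z / real n))"

definition commutator_subgroup :: "('g, 'b) monoid_scheme \<Rightarrow> 'g set" where
  "commutator_subgroup G = derived G (carrier G)"

definition abelianization :: "('g, 'b) monoid_scheme \<Rightarrow> ('g set) monoid" where
  "abelianization G = G Mod (commutator_subgroup G)"

definition ab_proj :: "('g, 'b) monoid_scheme \<Rightarrow> 'g \<Rightarrow> 'g set" where
  "ab_proj G g = commutator_subgroup G #>\<^bsub>G\<^esub> g"

end

theory Submission
  imports Defs
begin

text \<open>
  Only the bound of the pressure of the abelian extension by that of the \<open>G\<close>-extension is
  nontrivial. Let \<open>Z a n g\<close> be the weighted number of loops of length \<open>n\<close> at the symbol \<open>a\<close> whose
  cocycle is \<open>g\<close>. For \<open>s\<close> above the pressure of the \<open>G\<close>-extension, the Green function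
  \<open>H g = \<Sum>n\<ge>1. exp (- s n) * Z a n g\<close> is finite, is positive by transitivity, and by concatenation of
  loops and bounded distortion it is superharmonic up to a constant \<open>K\<close> that does not depend on \<open>m\<close>:
  \<open>\<Sum>k. exp (- s m) * Z a m k * H (k\<inverse>g) \<le> K * H g\<close>. The functions
  \<open>c k g = ln (H (k\<inverse>g)) - ln (H g)\<close> are bounded in \<open>g\<close> and form a cocycle in \<open>k\<close>, so their averages
  over a Folner sequence are asymptotically a homomorphism to the reals and tend to \<open>0\<close> on
  commutators. Averaging the superharmonic inequality gives
  \<open>\<Sum>k\<in>[G,G]. Z a m k \<le> K * exp (s m)\<close>.
\<close>

section \<open>Folner averages and superharmonic functions on countable amenable groups\<close>

text \<open>Countability exhausts the carrier by finite sets \<open>K n\<close>. A set that is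
  Folner for \<open>K n\<close> with tolerance \<open>1 / (n + 1)\<close> is chosen for each
  \<open>n\<close>, so one sequence serves every \<open>k\<close> at once.\<close>

lemma (in group) folner_sequence:
  assumes "amenable G" "countable (carrier G)"
  obtains F :: "nat \<Rightarrow> 'a set" where
    "\<And>n. finite (F n)" "\<And>n. F n \<subseteq> carrier G" "\<And>n. F n \<noteq> {}"
    "\<And>k. k \<in> carrier G \<Longrightarrow>
      (\<lambda>n. card (((\<otimes>) k ` F n - F n) \<union> (F n - (\<otimes>) k ` F n)) / card (F n)) \<longlonglongrightarrow> 0"
proof -
  define K where "K n = from_nat_into (carrier G) ` {..n}" for n
  have ne: "carrier G \<noteq> {}" by auto
  have K: "finite (K n)" "K n \<subseteq> carrier G" for n
    unfolding K_def using from_nat_into[OF ne] by auto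
  have "\<forall>n. \<exists>F. finite F \<and> F \<subseteq> carrier G \<and> F \<noteq> {} \<and>
         (\<forall>g \<in> K n. real (card (((\<otimes>) g ` F - F) \<union> (F - (\<otimes>) g ` F)))
                     < inverse (real (Suc n)) * real (card F))"
    using assms(1) K unfolding amenable_def by (meson inverse_positive_iff_positive of_nat_0_less_iff zero_less_Suc)
  then obtain F where F: "\<And>n. finite (F n) \<and> F n \<subseteq> carrier G \<and> F n \<noteq> {} \<and>
         (\<forall>g \<in> K n. real (card (((\<otimes>) g ` F n - F n) \<union> (F n - (\<otimes>) g ` F n)))
                     < inverse (real (Suc n)) * real (card (F n)))"
    by metis
  have "(\<lambda>n. card (((\<otimes>) k ` F n - F n) \<union> (F n - (\<otimes>) k ` F n)) / card (F n)) \<longlonglongrightarrow> 0"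
    if k: "k \<in> carrier G" for k
  proof -
    obtain N where N: "k = from_nat_into (carrier G) N"
      using from_nat_into_surj[OF assms(2) k] by metis
    have "\<forall>\<^sub>F n in sequentially. norm (card (((\<otimes>) k ` F n - F n) \<union> (F n - (\<otimes>) k ` F n)) / card (F n))
        \<le> inverse (real (Suc n))"
    proof (rule eventually_sequentiallyI[of N])
      fix n assume "N \<le> n"
      then have "k \<in> K n" using N by (auto simp: K_def)
      then have *: "real (card (((\<otimes>) k ` F n - F n) \<union> (F n - (\<otimes>) k ` F n)))
          < inverse (real (Suc n)) * real (card (F n))" using F by blast
      have "card (F n) > 0" using F by (simp add: card_gt_0_iff)
      then show "norm (card (((\<otimes>) k ` F n - F n) \<union> (F n - (\<otimes>) k ` F n)) / card (F n))
        \<le> inverse (real (Suc n))"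
        using * by (simp add: pos_divide_le_eq del: of_nat_Suc)
    qed
    then show ?thesis
      by (rule Lim_null_comparison) (rule LIMSEQ_inverse_real_of_nat)
  qed
  with F show ?thesis using that[of F] by blast
qed

lemma sum_diff_le_card_symdiff:
  fixes b :: "'a \<Rightarrow> real"
  assumes "finite S" "finite T" "\<And>g. g \<in> S \<union> T \<Longrightarrow> \<bar>b g\<bar> \<le> B"
  shows "\<bar>sum b S - sum b T\<bar> \<le> B * card ((S - T) \<union> (T - S))"
proof -
  have "sum b S = sum b (S - T) + sum b (S \<inter> T)" "sum b T = sum b (T - S) + sum b (S \<inter> T)"
    using sum.Int_Diff[OF assms(1), of b T] sum.Int_Diff[OF assms(2), of b S]
    by (simp_all add: Int_commute)
  then have "\<bar>sum b S - sum b T\<bar> = \<bar>sum b (S - T) - sum b (T - S)\<bar>" by simp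
  also have "\<dots> \<le> \<bar>sum b (S - T)\<bar> + \<bar>sum b (T - S)\<bar>" by (rule abs_triangle_ineq4)
  also have "\<dots> \<le> (\<Sum>g\<in>S - T. \<bar>b g\<bar>) + (\<Sum>g\<in>T - S. \<bar>b g\<bar>)"
    by (intro add_mono sum_abs)
  also have "\<dots> = (\<Sum>g\<in>(S - T) \<union> (T - S). \<bar>b g\<bar>)"
    using assms by (subst sum.union_disjoint) auto
  also have "\<dots> \<le> card ((S - T) \<union> (T - S)) * B"
    by (rule sum_bounded_above) (use assms in auto)
  finally show ?thesis by (simp add: mult.commute)
qed

text \<open>Left translation is injective, so the translated sum is a sum of \<open>b\<close> over
  the translate of \<open>F n\<close>. It differs from the sum over \<open>F n\<close> only on the
  symmetric difference, each point of which costs at most \<open>B\<close>.\<close>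

lemma (in group) folner_average_translate:
  fixes b :: "'a \<Rightarrow> real"
  assumes F: "\<And>n. finite (F n)" "\<And>n. F n \<subseteq> carrier G" "\<And>n. F n \<noteq> {}"
    and inv: "(\<lambda>n. card (((\<otimes>) (inv k) ` F n - F n) \<union> (F n - (\<otimes>) (inv k) ` F n)) / card (F n)) \<longlonglongrightarrow> 0"
    and k: "k \<in> carrier G" and b: "\<And>g. g \<in> carrier G \<Longrightarrow> \<bar>b g\<bar> \<le> B"
  shows "(\<lambda>n. (\<Sum>g\<in>F n. b (inv k \<otimes> g)) / card (F n) - (\<Sum>g\<in>F n. b g) / card (F n)) \<longlonglongrightarrow> 0"
proof (rule Lim_null_comparison)
  show "(\<lambda>n. B * (card (((\<otimes>) (inv k) ` F n - F n) \<union> (F n - (\<otimes>) (inv k) ` F n)) / card (F n))) \<longlonglongrightarrow> 0"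
    using tendsto_mult_left[OF inv, of B] by simp
  show "\<forall>\<^sub>F n in sequentially. norm ((\<Sum>g\<in>F n. b (inv k \<otimes> g)) / card (F n) - (\<Sum>g\<in>F n. b g) / card (F n))
     \<le> B * (card (((\<otimes>) (inv k) ` F n - F n) \<union> (F n - (\<otimes>) (inv k) ` F n)) / card (F n))"
  proof (rule always_eventually, rule allI)
    fix n
    have "inj_on ((\<otimes>) (inv k)) (F n)"
      using F(2)[of n] k by (intro inj_onI) (metis inv_closed l_cancel subsetD)
    then have "(\<Sum>g\<in>F n. b (inv k \<otimes> g)) = sum b ((\<otimes>) (inv k) ` F n)"
      by (simp add: sum.reindex)
    moreover have "\<bar>sum b ((\<otimes>) (inv k) ` F n) - sum b (F n)\<bar>
        \<le> B * card (((\<otimes>) (inv k) ` F n - F n) \<union> (F n - (\<otimes>) (inv k) ` F n))"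
      using F(1)[of n] F(2)[of n] k by (intro sum_diff_le_card_symdiff b) auto
    ultimately show "norm ((\<Sum>g\<in>F n. b (inv k \<otimes> g)) / card (F n) - (\<Sum>g\<in>F n. b g) / card (F n))
     \<le> B * (card (((\<otimes>) (inv k) ` F n - F n) \<union> (F n - (\<otimes>) (inv k) ` F n)) / card (F n))"
      by (simp add: diff_divide_distrib[symmetric] divide_right_mono)
  qed
qed

text \<open>Modulo null sequences, \<open>D\<close> is a homomorphism into an abelian group and
  therefore kills commutators. For general \<open>k\<close> the sequence \<open>D k\<close> may
  diverge; only the additivity defects are known to vanish.\<close>

lemma (in group) asymptotically_additive_derived:
  fixes D :: "'a \<Rightarrow> nat \<Rightarrow> real"
  assumes add: "\<And>k l. k \<in> carrier G \<Longrightarrow> l \<in> carrier G \<Longrightarrow>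
      (\<lambda>n. D (k \<otimes> l) n - D k n - D l n) \<longlonglongrightarrow> 0"
    and k: "k \<in> derived G (carrier G)"
  shows "D k \<longlonglongrightarrow> 0"
proof -
  have one: "D \<one> \<longlonglongrightarrow> 0"
    using tendsto_minus[OF add[of \<one> \<one>]] by simp
  have lim_inv: "(\<lambda>n. D (inv k) n + D k n) \<longlonglongrightarrow> 0" if "k \<in> carrier G" for k
    using tendsto_diff[OF one add[of "inv k" k]] that by simp
  have prod: "D (k \<otimes> l) \<longlonglongrightarrow> 0"
    if "D k \<longlonglongrightarrow> 0" "D l \<longlonglongrightarrow> 0" "k \<in> carrier G" "l \<in> carrier G" for k l
    using tendsto_add[OF tendsto_add[OF that(1,2)] add[OF that(3,4)]] by simp
  have comm: "D (a \<otimes> b \<otimes> inv a \<otimes> inv b) \<longlonglongrightarrow> 0"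
    if "a \<in> carrier G" "b \<in> carrier G" for a b
  proof -
    \<comment> \<open>The first three defects peel off the factors one by one; the last two terms
      cancel \<open>D a\<close> and \<open>D b\<close> against the values at their inverses. The sum
      telescopes to \<open>D\<close> of the commutator.\<close>
    have "(\<lambda>n. (D (a \<otimes> b \<otimes> inv a \<otimes> inv b) n - D (a \<otimes> b \<otimes> inv a) n - D (inv b) n)
       + (D (a \<otimes> b \<otimes> inv a) n - D (a \<otimes> b) n - D (inv a) n)
       + (D (a \<otimes> b) n - D a n - D b n)
       + (D (inv a) n + D a n) + (D (inv b) n + D b n)) \<longlonglongrightarrow> 0 + 0 + 0 + 0 + 0"
      by (intro tendsto_add add lim_inv) (use that in auto)
    then show ?thesis by simp
  qed
  have gen: "D h \<longlonglongrightarrow> 0 \<and> h \<in> carrier G" if "h \<in> derived_set G (carrier G)" for h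
    using that comm by auto
  have "D k \<longlonglongrightarrow> 0 \<and> k \<in> carrier G"
    using k unfolding derived_def
  proof (induction k rule: generate.induct)
    case one
    then show ?case using \<open>D \<one> \<longlonglongrightarrow> 0\<close> by simp
  next
    case (incl h)
    then show ?case by (rule gen)
  next
    case (inv h)
    then have h: "D h \<longlonglongrightarrow> 0" "h \<in> carrier G" using gen by blast+
    show ?case
      using tendsto_diff[OF lim_inv[OF h(2)] h(1)] h(2) by simp
  next
    case (eng h1 h2)
    then show ?case using prod by auto
  qed
  then show ?thesis ..
qed

text \<open>Dividing \<open>super\<close> by \<open>H g\<close> bounds a weighted sum of the ratios
  \<open>exp (c (\<kappa> x) g)\<close>. On the derived subgroup the Folner averages of
  \<open>c\<close> vanish in the limit, so on average these ratios count at least as much as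
  \<open>1\<close>. The weights are indexed by \<open>x\<close> instead of by group elements so that
  sums over periodic points can be inserted directly.\<close>

lemma (in group) superharmonic_mass_derived_le:
  fixes H :: "'a \<Rightarrow> real" and w :: "'x \<Rightarrow> real"
  assumes "amenable G" "countable (carrier G)"
    and H: "\<And>g. g \<in> carrier G \<Longrightarrow> H g > 0"
    and harnack: "\<And>k. k \<in> carrier G \<Longrightarrow> \<exists>B. \<forall>g \<in> carrier G. H (inv k \<otimes> g) \<le> B * H g"
    and \<kappa>: "\<And>x. x \<in> L \<Longrightarrow> \<kappa> x \<in> derived G (carrier G)"
    and w: "\<And>x. x \<in> L \<Longrightarrow> w x \<ge> 0"
    and super: "\<And>g. g \<in> carrier G \<Longrightarrow> (\<Sum>x\<in>L. w x * H (inv (\<kappa> x) \<otimes> g)) \<le> C * H g"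
  shows "sum w L \<le> C"
proof -
  obtain F :: "nat \<Rightarrow> 'a set" where F: "\<And>n. finite (F n)" "\<And>n. F n \<subseteq> carrier G" "\<And>n. F n \<noteq> {}"
    and Finv: "\<And>k. k \<in> carrier G \<Longrightarrow>
      (\<lambda>n. card (((\<otimes>) k ` F n - F n) \<union> (F n - (\<otimes>) k ` F n)) / card (F n)) \<longlonglongrightarrow> 0"
    using folner_sequence[OF assms(1,2)] by blast
  define c where "c k g = ln (H (inv k \<otimes> g)) - ln (H g)" for k g
  define D where "D k n = (\<Sum>g\<in>F n. c k g) / card (F n)" for k n
  have upper: "\<exists>B. \<forall>g\<in>carrier G. c k g \<le> B" if k: "k \<in> carrier G" for k
  proof -
    obtain B where B: "\<forall>g \<in> carrier G. H (inv k \<otimes> g) \<le> B * H g" using harnack[OF k] by blast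
    have "c k g \<le> ln B" if g: "g \<in> carrier G" for g
    proof -
      have pos: "H g > 0" "H (inv k \<otimes> g) > 0" using H g k by auto
      have le: "H (inv k \<otimes> g) \<le> B * H g" using B g by blast
      then have "0 < B * H g" using pos by linarith
      then have "B > 0" using pos zero_less_mult_pos2 by blast
      then show ?thesis
        using le pos ln_le_cancel_iff[of "H (inv k \<otimes> g)" "B * H g"] by (simp add: c_def ln_mult)
    qed
    then show ?thesis by blast
  qed
  have bdd: "\<exists>B. \<forall>g\<in>carrier G. \<bar>c k g\<bar> \<le> B" if k: "k \<in> carrier G" for k
  proof -
    obtain B1 where B1: "\<forall>g\<in>carrier G. c k g \<le> B1" using upper k by blast
    obtain B2 where B2: "\<forall>g\<in>carrier G. c (inv k) g \<le> B2" using upper[of "inv k"] k by auto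
    have "\<bar>c k g\<bar> \<le> max B1 B2" if g: "g \<in> carrier G" for g
    proof -
      \<comment> \<open>The Harnack bound for \<open>k\<close> only bounds \<open>c k\<close> from
        above; this identity turns the one for \<open>inv k\<close> into a lower bound.\<close>
      have "c (inv k) (inv k \<otimes> g) = - c k g"
        using k g by (simp add: c_def m_assoc[symmetric])
      moreover have "c (inv k) (inv k \<otimes> g) \<le> B2" using B2 k g by simp
      moreover have "c k g \<le> B1" using B1 g by blast
      ultimately show ?thesis by linarith
    qed
    then show ?thesis by blast
  qed
  have add: "(\<lambda>n. D (k \<otimes> l) n - D k n - D l n) \<longlonglongrightarrow> 0"
    if kl: "k \<in> carrier G" "l \<in> carrier G" for k l
  proof -
    obtain B where B: "\<And>g. g\<in>carrier G \<Longrightarrow> \<bar>c l g\<bar> \<le> B" using bdd kl by blast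
    \<comment> \<open>The cocycle identity for \<open>c\<close>. The translation by
      \<open>inv k\<close> in the first summand is absorbed by the Folner average because
      \<open>c l\<close> is bounded.\<close>
    have *: "(\<Sum>g\<in>F n. c (k \<otimes> l) g) = (\<Sum>g\<in>F n. c l (inv k \<otimes> g)) + (\<Sum>g\<in>F n. c k g)" for n
      unfolding sum.distrib[symmetric]
    proof (rule sum.cong)
      fix g assume "g \<in> F n"
      then have "g \<in> carrier G" using F by blast
      then show "c (k \<otimes> l) g = c l (inv k \<otimes> g) + c k g"
        using kl by (simp add: c_def inv_mult_group m_assoc)
    qed simp
    show ?thesis
      using folner_average_translate[OF F Finv[of "inv k"] kl(1) B] kl
      by (simp add: D_def * add_divide_distrib)
  qed
  have lim: "D (\<kappa> x) \<longlonglongrightarrow> 0" if "x \<in> L" for x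
    using asymptotically_additive_derived[of D, OF add \<kappa>[OF that]] by blast
  have bound: "(\<Sum>x\<in>L. w x * (1 + D (\<kappa> x) n)) \<le> C" for n
  proof -
    have cF: "real (card (F n)) > 0" using F by (simp add: card_gt_0_iff)
    have pt: "(\<Sum>x\<in>L. w x * (1 + c (\<kappa> x) g)) \<le> C" if g: "g \<in> carrier G" for g
    proof -
      have "(\<Sum>x\<in>L. w x * (1 + c (\<kappa> x) g)) \<le> (\<Sum>x\<in>L. w x * (H (inv (\<kappa> x) \<otimes> g) / H g))"
      proof (intro sum_mono mult_left_mono w)
        fix x assume x: "x \<in> L"
        have "\<kappa> x \<in> carrier G" using \<kappa>[OF x] derived_in_carrier[of "carrier G"] by auto
        then have "exp (c (\<kappa> x) g) = H (inv (\<kappa> x) \<otimes> g) / H g"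
          using H g by (simp add: c_def exp_diff)
        \<comment> \<open>this replaces Jensen's inequality for the exponential\<close>
        then show "1 + c (\<kappa> x) g \<le> H (inv (\<kappa> x) \<otimes> g) / H g"
          using exp_ge_add_one_self[of "c (\<kappa> x) g"] by simp
      qed
      also have "\<dots> = (\<Sum>x\<in>L. w x * H (inv (\<kappa> x) \<otimes> g)) / H g"
        by (simp add: sum_divide_distrib)
      also have "\<dots> \<le> C" using super[OF g] H[OF g] by (simp add: pos_divide_le_eq)
      finally show ?thesis .
    qed
    \<comment> \<open>The bound \<open>pt\<close> is affine in \<open>c\<close>, so averaging it
      over \<open>F n\<close> replaces \<open>c (\<kappa> x) g\<close> by
      \<open>D (\<kappa> x) n\<close>.\<close>
    have "(\<Sum>x\<in>L. w x * (1 + D (\<kappa> x) n)) * card (F n) = (\<Sum>x\<in>L. \<Sum>g\<in>F n. w x * (1 + c (\<kappa> x) g))"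
      unfolding sum_distrib_right
    proof (rule sum.cong)
      fix x
      have "(\<Sum>g\<in>F n. w x * (1 + c (\<kappa> x) g)) = w x * (card (F n) + (\<Sum>g\<in>F n. c (\<kappa> x) g))"
        by (simp add: sum_distrib_left[symmetric] sum.distrib)
      then show "w x * (1 + D (\<kappa> x) n) * card (F n) = (\<Sum>g\<in>F n. w x * (1 + c (\<kappa> x) g))"
        using cF by (simp add: D_def field_simps)
    qed simp
    also have "\<dots> = (\<Sum>g\<in>F n. \<Sum>x\<in>L. w x * (1 + c (\<kappa> x) g))" by (rule sum.swap)
    also have "\<dots> \<le> card (F n) * C" by (rule sum_bounded_above) (use pt F in blast)
    finally show ?thesis using cF by (simp add: mult.commute)
  qed
  have "(\<lambda>n. \<Sum>x\<in>L. w x * (1 + D (\<kappa> x) n)) \<longlonglongrightarrow> (\<Sum>x\<in>L. w x * (1 + 0))"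
    by (intro tendsto_sum tendsto_mult tendsto_add tendsto_const lim)
  from LIMSEQ_le_const2[OF this] bound show ?thesis by simp
qed

section \<open>Shift spaces, Birkhoff sums and bounded distortion\<close>

lemma shiftn_in_sft: "x \<in> sft A \<Longrightarrow> shiftn n x \<in> sft A"
  by (simp add: sft_def shiftn_def)

lemma shiftn_shiftn: "shiftn n (shiftn m x) = shiftn (n + m) x"
  by (simp add: shiftn_def add_ac)

lemma shiftn_0 [simp]: "shiftn 0 x = x"
  by (simp add: shiftn_def)

lemma birkhoff_add: "birkhoff f (n + m) x = birkhoff f n x + birkhoff f m (shiftn n x)"
  by (induction m) (simp_all add: birkhoff_def shiftn_shiftn add_ac)

lemma sdist_le_of_agree:
  assumes "\<And>i. i < n \<Longrightarrow> x i = y i"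
  shows "sdist x y \<le> (1/2) ^ n"
proof (cases "x = y")
  case False
  then obtain i where "x i \<noteq> y i" by blast
  then have "x (LEAST i. x i \<noteq> y i) \<noteq> y (LEAST i. x i \<noteq> y i)" by (rule LeastI)
  then have "n \<le> (LEAST i. x i \<noteq> y i)" using assms not_le by blast
  with False show ?thesis by (simp add: sdist_def power_decreasing)
qed (simp add: sdist_def)

text \<open>After \<open>k\<close> shifts the two points still agree on about \<open>n - k\<close>
  symbols, so the summands differ by a geometrically small amount. The geometric series bounds the
  total independently of \<open>n\<close>.\<close>

lemma holder_bounded_distortion:
  assumes "holder_cont A f"
  obtains C where "\<And>n x y. x \<in> sft A \<Longrightarrow> y \<in> sft A \<Longrightarrow> (\<And>i. i \<le> n \<Longrightarrow> x i = y i) \<Longrightarrow>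
    \<bar>birkhoff f n x - birkhoff f n y\<bar> \<le> C"
proof -
  obtain K \<alpha> where \<alpha>: "\<alpha> > 0"
    and K: "\<And>x y. x \<in> sft A \<Longrightarrow> y \<in> sft A \<Longrightarrow> \<bar>f x - f y\<bar> \<le> K * sdist x y powr \<alpha>"
    using assms unfolding holder_cont_def by blast
  define r :: real where "r = (1/2) powr \<alpha>"
  have r: "0 < r" "r < 1"
    using \<alpha> powr_less_mono2[of \<alpha> "1/2" 1] by (simp_all add: r_def)
  \<comment> \<open>The absolute value is taken because the Hoelder constant comes without a
    sign.\<close>
  have "\<bar>birkhoff f n x - birkhoff f n y\<bar> \<le> \<bar>K\<bar> * (1 / (1 - r))"
    if xy: "x \<in> sft A" "y \<in> sft A" and eq: "\<And>i. i \<le> n \<Longrightarrow> x i = y i" for n x y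
  proof -
    have *: "\<bar>f (shiftn k x) - f (shiftn k y)\<bar> \<le> \<bar>K\<bar> * r ^ (n - Suc k)" if k: "k < n" for k
    proof -
      \<comment> \<open>More coordinates than \<open>n - Suc k\<close> agree; with this exponent the
        sum over \<open>k < n\<close> reindexes to a partial geometric sum.\<close>
      have "sdist (shiftn k x) (shiftn k y) \<le> (1/2) ^ (n - Suc k)"
        by (rule sdist_le_of_agree) (use eq k in \<open>simp add: shiftn_def\<close>)
      moreover have "0 \<le> sdist (shiftn k x) (shiftn k y)" by (simp add: sdist_def)
      ultimately have "sdist (shiftn k x) (shiftn k y) powr \<alpha> \<le> ((1/2) ^ (n - Suc k)) powr \<alpha>"
        using \<alpha> by (intro powr_mono2) auto
      also have "\<dots> = r ^ (n - Suc k)"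
        by (simp add: r_def powr_power powr_realpow[symmetric] powr_powr mult.commute)
      finally have "\<bar>K\<bar> * sdist (shiftn k x) (shiftn k y) powr \<alpha> \<le> \<bar>K\<bar> * r ^ (n - Suc k)"
        by (rule mult_left_mono) simp
      moreover have "K * sdist (shiftn k x) (shiftn k y) powr \<alpha>
          \<le> \<bar>K\<bar> * sdist (shiftn k x) (shiftn k y) powr \<alpha>"
        by (intro mult_right_mono) auto
      ultimately show ?thesis
        using K[of "shiftn k x" "shiftn k y"] xy by (force simp: shiftn_in_sft)
    qed
    have "\<bar>birkhoff f n x - birkhoff f n y\<bar> \<le> (\<Sum>k<n. \<bar>f (shiftn k x) - f (shiftn k y)\<bar>)"
      unfolding birkhoff_def sum_subtractf[symmetric] by (rule sum_abs)
    also have "\<dots> \<le> (\<Sum>k<n. \<bar>K\<bar> * r ^ (n - Suc k))"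
      by (intro sum_mono *) simp
    also have "\<dots> = \<bar>K\<bar> * (\<Sum>k<n. r ^ k)"
      by (simp add: sum_distrib_left[symmetric] sum.nat_diff_reindex[of "\<lambda>k. r ^ k"])
    also have "\<dots> \<le> \<bar>K\<bar> * (1 / (1 - r))"
    proof (rule mult_left_mono)
      have "(\<Sum>k<n. r ^ k) \<le> suminf ((^) r)"
        using r by (intro sum_le_suminf summable_geometric) auto
      then show "(\<Sum>k<n. r ^ k) \<le> 1 / (1 - r)"
        using r by (simp add: suminf_geometric)
    qed simp
    finally show ?thesis .
  qed
  then show ?thesis using that by blast
qed

section \<open>Periodic points and concatenation of loops\<close>

text \<open>Fixing \<open>x 0\<close> makes these points closed paths at the vertex
  \<open>a\<close>, so that any two can be concatenated. For \<open>n = 0\<close> periodicity is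
  void, hence the bound \<open>n \<ge> 1\<close> in what follows.\<close>

definition periodic_at :: "('a \<Rightarrow> 'a \<Rightarrow> bool) \<Rightarrow> nat \<Rightarrow> 'a \<Rightarrow> (nat \<Rightarrow> 'a) set" where
  "periodic_at A n a = {x \<in> sft A. shiftn n x = x \<and> x 0 = a}"

lemma periodic_mod:
  assumes "shiftn n x = x"
  shows "x i = x (i mod n)"
proof -
  have "x (j + k * n) = x j" for j k
  proof (induction k)
    case (Suc k)
    have "x (j + Suc k * n) = shiftn n x (j + k * n)" by (simp add: shiftn_def add_ac)
    with Suc assms show ?case by simp
  qed simp
  from this[of "i mod n" "i div n"] show ?thesis by simp
qed

text \<open>A point of period \<open>n\<close> is determined by its first \<open>n\<close> symbols,
  and the alphabet is finite.\<close>

lemma finite_periodic: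
  fixes A :: "'a::finite \<Rightarrow> 'a \<Rightarrow> bool"
  assumes "n \<ge> 1"
  shows "finite {x \<in> sft A. shiftn n x = x}"
proof (rule inj_on_finite)
  show "inj_on (\<lambda>x. map x [0..<n]) {x \<in> sft A. shiftn n x = x}"
  proof (rule inj_onI, rule ext)
    fix x y i
    assume x: "x \<in> {x \<in> sft A. shiftn n x = x}" and y: "y \<in> {x \<in> sft A. shiftn n x = x}"
      and eq: "map x [0..<n] = map y [0..<n]"
    have "x (i mod n) = y (i mod n)" using eq assms by simp
    then show "x i = y i" using x y periodic_mod[of n x i] periodic_mod[of n y i] by simp
  qed
  show "(\<lambda>x. map x [0..<n]) ` {x \<in> sft A. shiftn n x = x} \<subseteq> {xs. set xs \<subseteq> UNIV \<and> length xs = n}"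
    by auto
  show "finite {xs :: 'a list. set xs \<subseteq> UNIV \<and> length xs = n}"
    by (rule finite_lists_length_eq) simp
qed

lemma finite_periodic_at:
  fixes A :: "'a::finite \<Rightarrow> 'a \<Rightarrow> bool"
  shows "n \<ge> 1 \<Longrightarrow> finite (periodic_at A n a)"
  by (rule finite_subset[OF _ finite_periodic[of n A]]) (auto simp: periodic_at_def)

definition close_up :: "nat \<Rightarrow> (nat \<Rightarrow> 'a) \<Rightarrow> nat \<Rightarrow> 'a" where
  "close_up n z = (\<lambda>i. z (i mod n))"

text \<open>The endpoint \<open>i = n\<close> is where \<open>z n = z 0\<close> enters. It has to be
  included because the cocycle over \<open>n\<close> steps also reads the symbol at time
  \<open>n\<close>.\<close>

lemma close_up_agree: "z n = z 0 \<Longrightarrow> i \<le> n \<Longrightarrow> close_up n z i = z i"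
  by (cases "i = n") (simp_all add: close_up_def)

lemma close_up_periodic_at:
  assumes "n \<ge> 1" "z n = z 0" "\<And>i. i < n \<Longrightarrow> A (z i) (z (Suc i))"
  shows "close_up n z \<in> periodic_at A n (z 0)"
proof -
  have "A (close_up n z i) (close_up n z (Suc i))" for i
  proof -
    have "i mod n < n" using assms(1) by simp
    then have "A (z (i mod n)) (z (Suc (i mod n)))" by (rule assms(3))
    moreover have "z (Suc (i mod n)) = close_up n z (Suc (i mod n))"
      using \<open>i mod n < n\<close> by (intro close_up_agree[symmetric] assms) auto
    moreover have "\<dots> = close_up n z (Suc i)"
      by (simp add: close_up_def mod_Suc_eq)
    ultimately show ?thesis by (simp add: close_up_def)
  qed
  then show ?thesis
    by (auto simp: periodic_at_def sft_def close_up_def shiftn_def)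
qed

text \<open>The concatenation of a loop of length \<open>n\<close> with one of length
  \<open>m\<close>, repeated periodically.\<close>

definition splice_at :: "nat \<Rightarrow> nat \<Rightarrow> (nat \<Rightarrow> 'a) \<Rightarrow> (nat \<Rightarrow> 'a) \<Rightarrow> nat \<Rightarrow> 'a" where
  "splice_at n m x y = close_up (n + m) (\<lambda>i. if i < n then x i else y (i - n))"

context
  fixes A :: "'a \<Rightarrow> 'a \<Rightarrow> bool" and n m a x y
  assumes n: "n \<ge> 1" and m: "m \<ge> 1"
    and x: "x \<in> periodic_at A n a" and y: "y \<in> periodic_at A m a"
begin

lemma splice_ends: "x 0 = a" "x n = a" "y 0 = a" "y m = a"
  using x y periodic_mod[of n x n] periodic_mod[of m y m] by (auto simp: periodic_at_def)

lemma splice_at_left: "i \<le> n \<Longrightarrow> splice_at n m x y i = x i"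
  unfolding splice_at_def using n m splice_ends
  by (subst close_up_agree) (auto simp: le_less)

lemma splice_at_right: "i \<le> m \<Longrightarrow> splice_at n m x y (i + n) = y i"
  unfolding splice_at_def using n m splice_ends
  by (subst close_up_agree) auto

lemma splice_at_periodic: "splice_at n m x y \<in> periodic_at A (n + m) a"
proof -
  define z where "z = (\<lambda>i. if i < n then x i else y (i - n))"
  have "close_up (n + m) z \<in> periodic_at A (n + m) (z 0)"
  proof (rule close_up_periodic_at)
    show "1 \<le> n + m" using n by simp
    show "z (n + m) = z 0" using n splice_ends by (simp add: z_def)
    fix i
    have Ax: "A (x i) (x (Suc i))" and Ay: "A (y (i - n)) (y (Suc (i - n)))"
      using x y by (auto simp: periodic_at_def sft_def)
    show "A (z i) (z (Suc i))"
    proof (cases "Suc i = n")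
      case True
      then show ?thesis using Ax splice_ends by (auto simp: z_def)
    next
      case False
      then show ?thesis using Ax Ay by (auto simp: z_def Suc_diff_le)
    qed
  qed
  moreover have "z 0 = a" using n splice_ends by (simp add: z_def)
  ultimately show ?thesis by (simp add: z_def splice_at_def)
qed

end

text \<open>The two windows of the splice recover a full period of each loop. This lets a sum over
  pairs of loops be bounded by a sum over longer loops.\<close>

lemma splice_at_inject:
  assumes "n \<ge> 1" "m \<ge> 1" "x \<in> periodic_at A n a" "y \<in> periodic_at A m a"
    "x' \<in> periodic_at A n a" "y' \<in> periodic_at A m a"
    and eq: "splice_at n m x y = splice_at n m x' y'"
  shows "x = x' \<and> y = y'"
proof -
  have "x i = x' i" if "i \<le> n" for i
    using splice_at_left[OF assms(1-4) that] splice_at_left[OF assms(1,2,5,6) that] eq by simp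
  moreover have "y i = y' i" if "i \<le> m" for i
    using splice_at_right[OF assms(1-4) that] splice_at_right[OF assms(1,2,5,6) that] eq by simp
  ultimately have mod_eq: "x (i mod n) = x' (i mod n)" "y (i mod m) = y' (i mod m)" for i
    using assms(1,2) by (simp_all add: order.strict_implies_order)
  have per: "shiftn n x = x" "shiftn n x' = x'" "shiftn m y = y" "shiftn m y' = y'"
    using assms by (simp_all add: periodic_at_def)
  have "x i = x' i" "y i = y' i" for i
    using periodic_mod[OF per(1), of i] periodic_mod[OF per(2), of i] periodic_mod[OF per(3), of i]
      periodic_mod[OF per(4), of i] mod_eq[of i] by metis+
  then show ?thesis by (simp add: fun_eq_iff)
qed

section \<open>Cocycles and weighted loop counts of the skew product\<close>

text \<open>Regularity of \<open>f\<close> is recorded only through the distortion constant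
  \<open>C\<close>, a parameter of the locale so that later estimates can name their
  constants.\<close>

locale skew_product = group G
  for G :: "('g, 'b) monoid_scheme" (structure) +
  fixes A :: "'a::finite \<Rightarrow> 'a \<Rightarrow> bool" and psi :: "(nat \<Rightarrow> 'a) \<Rightarrow> 'g"
    and f :: "(nat \<Rightarrow> 'a) \<Rightarrow> real" and C :: real
  assumes psi_closed: "x \<in> sft A \<Longrightarrow> psi x \<in> carrier G"
    and psi_local: "x \<in> sft A \<Longrightarrow> y \<in> sft A \<Longrightarrow> x 0 = y 0 \<Longrightarrow> x 1 = y 1 \<Longrightarrow> psi x = psi y"
    and distortion: "x \<in> sft A \<Longrightarrow> y \<in> sft A \<Longrightarrow> (\<And>i. i \<le> n \<Longrightarrow> x i = y i) \<Longrightarrow>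
      \<bar>birkhoff f n x - birkhoff f n y\<bar> \<le> C"
    and transitive: "skew_transitive A G psi"
begin

lemma cocycle_closed: "x \<in> sft A \<Longrightarrow> cocycle G psi n x \<in> carrier G"
  by (induction n arbitrary: x) (simp_all add: psi_closed shiftn_in_sft)

lemma cocycle_add:
  "x \<in> sft A \<Longrightarrow> cocycle G psi (n + m) x = cocycle G psi n x \<otimes> cocycle G psi m (shiftn n x)"
  by (induction n arbitrary: x)
    (simp_all add: cocycle_closed psi_closed shiftn_in_sft m_assoc shiftn_shiftn)

lemma cocycle_local:
  "x \<in> sft A \<Longrightarrow> y \<in> sft A \<Longrightarrow> (\<And>i. i \<le> n \<Longrightarrow> x i = y i) \<Longrightarrow> cocycle G psi n x = cocycle G psi n y"
proof (induction n arbitrary: x y)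
  case (Suc n)
  have "cocycle G psi n (shiftn 1 x) = cocycle G psi n (shiftn 1 y)"
    using Suc.prems by (intro Suc.IH shiftn_in_sft) (auto simp: shiftn_def)
  moreover have "psi x = psi y" using Suc.prems by (intro psi_local) auto
  ultimately show ?case by simp
qed simp

lemma periodic_at_sft: "x \<in> periodic_at A n a \<Longrightarrow> x \<in> sft A"
  by (simp add: periodic_at_def)

text \<open>Cut the splice at time \<open>n\<close>: up to and including its endpoint, each piece
  agrees with the corresponding loop. The cocycles therefore agree exactly, while each Birkhoff sum
  changes by at most \<open>C\<close>.\<close>

lemma
  assumes n: "n \<ge> 1" "m \<ge> 1" and xy: "x \<in> periodic_at A n a" "y \<in> periodic_at A m a"
  shows cocycle_splice:
      "cocycle G psi (n + m) (splice_at n m x y) = cocycle G psi n x \<otimes> cocycle G psi m y"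
    and birkhoff_splice:
      "birkhoff f n x + birkhoff f m y \<le> birkhoff f (n + m) (splice_at n m x y) + 2 * C"
proof -
  let ?z = "splice_at n m x y"
  have z: "?z \<in> sft A" using splice_at_periodic[OF n xy] periodic_at_sft by blast
  have l: "?z i = x i" if "i \<le> n" for i using splice_at_left[OF n xy that] .
  have r: "shiftn n ?z i = y i" if "i \<le> m" for i
    using splice_at_right[OF n xy that] by (simp add: shiftn_def)
  show "cocycle G psi (n + m) ?z = cocycle G psi n x \<otimes> cocycle G psi m y"
    using cocycle_local[OF z periodic_at_sft[OF xy(1)] l]
      cocycle_local[OF shiftn_in_sft[OF z] periodic_at_sft[OF xy(2)] r]
    by (simp add: cocycle_add z)
  show "birkhoff f n x + birkhoff f m y \<le> birkhoff f (n + m) ?z + 2 * C"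
    using distortion[OF z periodic_at_sft[OF xy(1)] l, of n]
      distortion[OF shiftn_in_sft[OF z] periodic_at_sft[OF xy(2)] r, of m]
    by (simp add: birkhoff_add abs_le_iff)
qed

definition Z :: "'a \<Rightarrow> nat \<Rightarrow> 'g \<Rightarrow> real" where
  "Z a n g = (\<Sum>x \<in> {x \<in> periodic_at A n a. cocycle G psi n x = g}. exp (birkhoff f n x))"

lemma Z_nonneg: "Z a n g \<ge> 0"
  by (simp add: Z_def sum_nonneg)

text \<open>A loop \<open>x\<close> from \<open>L\<close> followed by a loop with the complementary
  cocycle is a loop with cocycle \<open>g\<close>, and distinct pairs give distinct loops. Arbitrary
  \<open>L\<close> is allowed because both single loops and all loops with cocycle in the derived
  subgroup are inserted later.\<close>

lemma Z_convolution:
  assumes m: "m \<ge> 1" and n: "n \<ge> 1" and g: "g \<in> carrier G" and L: "L \<subseteq> periodic_at A m a"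
  shows "(\<Sum>x\<in>L. exp (birkhoff f m x) * Z a n (inv (cocycle G psi m x) \<otimes> g))
    \<le> exp (2 * C) * Z a (m + n) g"
proof -
  define S where "S x = {y \<in> periodic_at A n a. cocycle G psi n y = inv (cocycle G psi m x) \<otimes> g}" for x
  have fin: "finite L" "finite (S x)" for x
    using finite_subset[OF L finite_periodic_at[OF m]]
      finite_subset[OF _ finite_periodic_at[OF n, of A a], of "S x"] by (auto simp: S_def)
  have S: "y \<in> periodic_at A n a" if "y \<in> S x" for x y using that by (simp add: S_def)
  have "(\<Sum>x\<in>L. exp (birkhoff f m x) * Z a n (inv (cocycle G psi m x) \<otimes> g))
      = (\<Sum>x\<in>L. \<Sum>y\<in>S x. exp (birkhoff f m x + birkhoff f n y))"
    by (simp add: Z_def S_def sum_distrib_left exp_add)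
  also have "\<dots> = (\<Sum>(x, y)\<in>Sigma L S. exp (birkhoff f m x + birkhoff f n y))"
    using fin by (subst sum.Sigma) auto
  also have "\<dots> \<le> (\<Sum>(x, y)\<in>Sigma L S. exp (2 * C) * exp (birkhoff f (m + n) (splice_at m n x y)))"
  proof (rule sum_mono, clarsimp)
    fix x y assume "x \<in> L" "y \<in> S x"
    then show "exp (birkhoff f m x + birkhoff f n y)
        \<le> exp (2 * C) * exp (birkhoff f (m + n) (splice_at m n x y))"
      using birkhoff_splice[OF m n, of x a y] L S by (auto simp: exp_add[symmetric] add_ac)
  qed
  also have "\<dots> = exp (2 * C) *
      (\<Sum>z\<in>(\<lambda>(x, y). splice_at m n x y) ` Sigma L S. exp (birkhoff f (m + n) z))"
  proof -
    have "inj_on (\<lambda>(x, y). splice_at m n x y) (Sigma L S)"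
    proof (rule inj_onI, clarify)
      fix x y x' y'
      assume "x \<in> L" "y \<in> S x" "x' \<in> L" "y' \<in> S x'" and eq: "splice_at m n x y = splice_at m n x' y'"
      then have "x \<in> periodic_at A m a" "y \<in> periodic_at A n a"
        "x' \<in> periodic_at A m a" "y' \<in> periodic_at A n a"
        using L S by blast+
      from splice_at_inject[OF m n this eq] show "x = x' \<and> y = y'" .
    qed
    then show ?thesis
      by (simp add: sum.reindex sum_distrib_left case_prod_unfold)
  qed
  also have "\<dots> \<le> exp (2 * C) * Z a (m + n) g"
    unfolding Z_def
  proof (intro mult_left_mono sum_mono2)
    show "finite {x \<in> periodic_at A (m + n) a. cocycle G psi (m + n) x = g}"
      using finite_periodic_at[of "m + n" A a] m by simp
    show "(\<lambda>(x, y). splice_at m n x y) ` Sigma L S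
        \<subseteq> {x \<in> periodic_at A (m + n) a. cocycle G psi (m + n) x = g}"
    proof clarsimp
      fix x y assume xy: "x \<in> L" "y \<in> S x"
      then have x: "x \<in> periodic_at A m a" and y: "y \<in> periodic_at A n a" using L S by auto
      have "cocycle G psi m x \<otimes> (inv (cocycle G psi m x) \<otimes> g) = g"
        using cocycle_closed[OF periodic_at_sft[OF x]] g by (simp add: m_assoc[symmetric])
      then have "cocycle G psi (m + n) (splice_at m n x y) = g"
        using cocycle_splice[OF m n x y] xy by (simp add: S_def)
      then show "splice_at m n x y \<in> periodic_at A (m + n) a \<and>
          cocycle G psi (m + n) (splice_at m n x y) = g"
        using splice_at_periodic[OF m n x y] by simp
    qed
  qed auto
  finally show ?thesis .
qed

text \<open>Transitivity from the cylinder of \<open>a\<close> to itself gives an orbit segment that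
  returns to \<open>a\<close> with cocycle \<open>g\<close>; closing it up keeps its symbols through
  time \<open>n\<close> and hence its cocycle.\<close>

lemma periodic_at_cocycle_exists:
  assumes "x0 \<in> sft A" "x0 0 = a" and g: "g \<in> carrier G"
  shows "\<exists>n\<ge>1. \<exists>x \<in> periodic_at A n a. cocycle G psi n x = g"
proof -
  have "cyl A [a] \<noteq> {}" using assms by (auto simp: cyl_def)
  then obtain n x where n: "n \<ge> 1" and x: "x \<in> cyl A [a]" "shiftn n x \<in> cyl A [a]"
    and c: "\<one> \<otimes> cocycle G psi n x = g"
    using transitive g unfolding skew_transitive_def by blast
  have xs: "x \<in> sft A" "x 0 = a" "x n = a"
    using x by (auto simp: cyl_def shiftn_def)
  have p: "close_up n x \<in> periodic_at A n a"
    using close_up_periodic_at[OF n, of x A] xs by (auto simp: sft_def)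
  have "cocycle G psi n (close_up n x) = cocycle G psi n x"
    by (rule cocycle_local) (use p periodic_at_sft xs close_up_agree[of x n] in auto)
  then show ?thesis using n p c xs cocycle_closed by auto
qed

section \<open>The Green function and the mass of loops over the commutator subgroup\<close>

text \<open>The factor \<open>exp (2 * C)\<close> is uniform in \<open>m\<close>, so it does not
  affect the exponential growth rate. It is the superharmonicity constant of the Green function
  \<open>H\<close> built below.\<close>

lemma derived_periodic_sum_le:
  assumes am: "amenable G" "countable (carrier G)"
    and s: "gurevic_pressure A G psi f < ereal s" and m: "m \<ge> 1"
  shows "(\<Sum>x \<in> {x \<in> periodic_at A m a. cocycle G psi m x \<in> derived G (carrier G)}.
      exp (birkhoff f m x)) \<le> exp (2 * C) * exp (s * m)"
    (is "sum _ ?L \<le> _")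
proof (cases "periodic_at A m a = {}")
  case True
  then show ?thesis by simp
next
  case False
  then obtain x0 where x0: "x0 \<in> sft A" "x0 0 = a" by (auto simp: periodic_at_def)
  \<comment> \<open>The gap between \<open>t\<close> and \<open>s\<close> makes the Green series
    converge: its terms will be compared with powers of \<open>exp (t - s) < 1\<close>.\<close>
  obtain t where t: "gurevic_pressure A G psi f < ereal t" "t < s"
    using ereal_dense2[OF s] by auto
  let ?Zfull = "\<lambda>n. \<Sum>x \<in> {x \<in> sft A. shiftn n x = x \<and> cocycle G psi n x = \<one>}. exp (birkhoff f n x)"
  obtain N where N: "\<And>n. n \<ge> N \<Longrightarrow>
      (if ?Zfull n = 0 then -\<infinity> else ereal (ln (?Zfull n) / real n)) < ereal t"
    using Limsup_lessD[OF t(1)[unfolded gurevic_pressure_def Let_def]]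
    unfolding eventually_sequentially by blast
  have Zone: "Z a n \<one> \<le> exp (t * n)" if n: "n \<ge> N" "n \<ge> 1" for n
  proof -
    have "Z a n \<one> \<le> ?Zfull n"
      unfolding Z_def
      by (rule sum_mono2) (auto intro: finite_subset[OF _ finite_periodic[OF n(2)]] simp: periodic_at_def)
    also have "\<dots> \<le> exp (t * n)"
    proof (cases "?Zfull n = 0")
      case False
      then have "ln (?Zfull n) / n < t" using N[OF n(1)] by simp
      then have "exp (ln (?Zfull n)) \<le> exp (t * n)" using n by (simp add: field_simps)
      moreover have "?Zfull n > 0"
        using False sum_nonneg[of "{x \<in> sft A. shiftn n x = x \<and> cocycle G psi n x = \<one>}"
            "\<lambda>x. exp (birkhoff f n x)"] by simp
      ultimately show ?thesis by simp
    qed simp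
    finally show ?thesis .
  qed
  \<comment> \<open>The index is shifted by one: \<open>T g n\<close> belongs to loops of length
    \<open>Suc n\<close>, so that length \<open>0\<close> is left out of the series.\<close>
  define T where "T g n = exp (- s * Suc n) * Z a (Suc n) g" for g n
  have summ: "summable (T g)" if g: "g \<in> carrier G" for g
  proof -
    \<comment> \<open>Prefixing this fixed loop turns loops with cocycle \<open>g\<close> into loops
      with trivial cocycle, whose weight is controlled by \<open>Zone\<close>.\<close>
    obtain k x where k: "k \<ge> 1" and x: "x \<in> periodic_at A k a" and cx: "cocycle G psi k x = inv g"
      using periodic_at_cocycle_exists[OF x0, of "inv g"] g by auto
    define B where "B = exp (2 * C) * exp (t * k) * exp (- birkhoff f k x)"
    have ZB: "Z a n g \<le> B * exp (t * n)" if n: "n \<ge> N" "n \<ge> 1" for n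
    proof -
      have "exp (birkhoff f k x) * Z a n g \<le> exp (2 * C) * Z a (k + n) \<one>"
        using Z_convolution[OF k n(2), of \<one> "{x}" a] x cx g by simp
      also have "\<dots> \<le> exp (2 * C) * exp (t * (k + n))"
        using Zone[of "k + n"] n by simp
      finally show ?thesis by (simp add: B_def exp_minus field_simps exp_add)
    qed
    have "norm (T g n) \<le> B * exp (t - s) * exp (t - s) ^ n" if "n \<ge> N" for n
    proof -
      have "T g n \<le> exp (- s * Suc n) * (B * exp (t * Suc n))"
        unfolding T_def by (intro mult_left_mono ZB) (use that in auto)
      also have "\<dots> = B * (exp (- s * Suc n) * exp (t * Suc n))" by simp
      also have "\<dots> = B * exp (t - s) ^ Suc n"
        by (simp only: exp_add[symmetric] exp_of_nat_mult[symmetric]) (simp add: algebra_simps)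
      finally show ?thesis using Z_nonneg[of a "Suc n" g] by (simp add: T_def mult_ac)
    qed
    moreover have "summable (\<lambda>n. B * exp (t - s) * exp (t - s) ^ n)"
      using t(2) by (intro summable_mult summable_geometric) simp
    ultimately show ?thesis by (rule summable_comparison_test'[rotated])
  qed
  define H where "H g = suminf (T g)" for g
  have T_nonneg: "T g n \<ge> 0" for g n by (simp add: T_def Z_nonneg)
  have superharmonic: "(\<Sum>x\<in>L. exp (birkhoff f k x - s * k) * H (inv (cocycle G psi k x) \<otimes> g))
      \<le> exp (2 * C) * H g"
    if k: "k \<ge> 1" and L: "L \<subseteq> periodic_at A k a" and g: "g \<in> carrier G" for k L g
  proof -
    let ?w = "\<lambda>x. exp (birkhoff f k x - s * k)" and ?h = "\<lambda>x. inv (cocycle G psi k x) \<otimes> g"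
    have h: "?h x \<in> carrier G" if "x \<in> L" for x
      using that L g cocycle_closed periodic_at_sft by blast
    have sm: "summable (\<lambda>n. \<Sum>x\<in>L. ?w x * T (?h x) n)"
      by (intro summable_sum summable_mult summ h)
    \<comment> \<open>Prefixing loops of length \<open>k\<close> moves index \<open>n\<close> to
      \<open>n + k\<close>, so summation over \<open>n\<close> yields a tail of the series for
      \<open>H g\<close>, which is at most \<open>H g\<close> since the terms are
      nonnegative.\<close>
    have le: "(\<Sum>x\<in>L. ?w x * T (?h x) n) \<le> exp (2 * C) * T g (n + k)" for n
    proof -
      have "(\<Sum>x\<in>L. ?w x * T (?h x) n)
          = exp (- s * Suc (n + k)) * (\<Sum>x\<in>L. exp (birkhoff f k x) * Z a (Suc n) (?h x))"
        by (auto simp: T_def sum_distrib_left exp_diff exp_minus exp_add field_simps intro!: sum.cong)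
      also have "\<dots> \<le> exp (- s * Suc (n + k)) * (exp (2 * C) * Z a (k + Suc n) g)"
        using Z_convolution[OF k _ g L, of "Suc n"] by (intro mult_left_mono) auto
      finally show ?thesis by (simp add: T_def mult_ac add_ac)
    qed
    have "(\<Sum>x\<in>L. ?w x * H (?h x)) = suminf (\<lambda>n. \<Sum>x\<in>L. ?w x * T (?h x) n)"
      unfolding H_def using h summ
      by (subst suminf_sum) (auto intro!: summable_mult sum.cong simp: suminf_mult)
    also have "\<dots> \<le> suminf (\<lambda>n. exp (2 * C) * T g (n + k))"
      using summ[OF g] by (intro suminf_le le sm summable_mult summable_ignore_initial_segment)
    also have "\<dots> = exp (2 * C) * suminf (\<lambda>n. T g (n + k))"
      using summ[OF g] by (intro suminf_mult summable_ignore_initial_segment)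
    also have "\<dots> \<le> exp (2 * C) * H g"
      using suminf_split_initial_segment[OF summ[OF g], of k] T_nonneg
      by (simp add: H_def sum_nonneg)
    finally show ?thesis .
  qed
  have "sum (\<lambda>x. exp (birkhoff f m x - s * m)) ?L \<le> exp (2 * C)"
  proof (rule superharmonic_mass_derived_le[OF am, where \<kappa> = "cocycle G psi m" and H = H])
    fix g assume g: "g \<in> carrier G"
    show "H g > 0"
    proof -
      obtain k x where k: "k \<ge> 1" and x: "x \<in> periodic_at A k a" "cocycle G psi k x = g"
        using periodic_at_cocycle_exists[OF x0 g] by auto
      have "Z a k g > 0"
        unfolding Z_def
        by (rule sum_pos) (use x finite_periodic_at[OF k, of A a] in auto)
      then have "T g (k - 1) > 0" using k by (simp add: T_def)
      then show ?thesis
        unfolding H_def using summ[OF g] T_nonneg by (intro suminf_pos2) auto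
    qed
    show "(\<Sum>x\<in>?L. exp (birkhoff f m x - s * m) * H (inv (cocycle G psi m x) \<otimes> g)) \<le> exp (2 * C) * H g"
      by (rule superharmonic[OF m _ g]) auto
  next
    fix l assume l: "l \<in> carrier G"
    obtain k x where k: "k \<ge> 1" and x: "x \<in> periodic_at A k a" and cx: "cocycle G psi k x = l"
      using periodic_at_cocycle_exists[OF x0 l] by auto
    \<comment> \<open>The Harnack inequality comes from superharmonicity by keeping a single loop
      with cocycle \<open>l\<close>.\<close>
    have "H (inv l \<otimes> g) \<le> exp (2 * C) / exp (birkhoff f k x - s * k) * H g" if "g \<in> carrier G" for g
      using superharmonic[OF k _ that, of "{x}"] x cx by (simp add: field_simps)
    then show "\<exists>B. \<forall>g \<in> carrier G. H (inv l \<otimes> g) \<le> B * H g" by blast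
  qed auto
  then show ?thesis
    by (simp add: exp_diff sum_divide_distrib[symmetric] field_simps)
qed

section \<open>Comparison with the pressure of the abelian extension\<close>

lemma ab_cocycle:
  "x \<in> sft A \<Longrightarrow> cocycle (abelianization G) (\<lambda>x. ab_proj G (psi x)) n x = ab_proj G (cocycle G psi n x)"
proof (induction n arbitrary: x)
  case 0
  have "commutator_subgroup G \<subseteq> carrier G"
    unfolding commutator_subgroup_def by (rule derived_in_carrier) simp
  then show ?case by (simp add: abelianization_def ab_proj_def)
next
  case (Suc n)
  have "commutator_subgroup G \<lhd> G"
    unfolding commutator_subgroup_def by (rule derived_self_is_normal)
  then show ?case
    using Suc.IH[OF shiftn_in_sft[OF Suc.prems, of 1]] psi_closed[OF Suc.prems]
      cocycle_closed[OF shiftn_in_sft[OF Suc.prems, of 1], of n]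
    by (simp add: abelianization_def ab_proj_def normal.rcos_sum)
qed

lemma ab_cocycle_eq_one_iff:
  assumes "x \<in> sft A"
  shows "cocycle (abelianization G) (\<lambda>x. ab_proj G (psi x)) n x = \<one>\<^bsub>abelianization G\<^esub>
    \<longleftrightarrow> cocycle G psi n x \<in> derived G (carrier G)"
proof -
  have "subgroup (derived G (carrier G)) G" by (rule derived_is_subgroup) simp
  then have "derived G (carrier G) #> g = derived G (carrier G) \<longleftrightarrow> g \<in> derived G (carrier G)"
    if "g \<in> carrier G" for g
    using that coset_join1 coset_join2 by blast
  then show ?thesis
    using assms cocycle_closed
    by (simp add: ab_cocycle) (simp add: abelianization_def ab_proj_def commutator_subgroup_def)
qed

text \<open>The kernel of the projection is the derived subgroup. Both pressures thus become growth
  rates over periodic points of the same shift, with different conditions on the same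
  cocycle.\<close>

lemma gurevic_pressure_abelianization:
  "gurevic_pressure A (abelianization G) (\<lambda>x. ab_proj G (psi x)) f = limsup (\<lambda>n.
    let Z = \<Sum>x \<in> {x \<in> sft A. shiftn n x = x \<and> cocycle G psi n x \<in> derived G (carrier G)}.
      exp (birkhoff f n x)
    in if Z = 0 then -\<infinity> else ereal (ln Z / real n))"
proof -
  have "{x \<in> sft A. shiftn n x = x \<and>
        cocycle (abelianization G) (\<lambda>x. ab_proj G (psi x)) n x = \<one>\<^bsub>abelianization G\<^esub>}
      = {x \<in> sft A. shiftn n x = x \<and> cocycle G psi n x \<in> derived G (carrier G)}" for n
    using ab_cocycle_eq_one_iff by blast
  then show ?thesis by (simp only: gurevic_pressure_def)
qed

text \<open>The identity lies in the derived subgroup, so the abelian sum contains all the terms of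
  the other one, and all terms are positive.\<close>

lemma gurevic_pressure_le_abelianization:
  "gurevic_pressure A G psi f \<le> gurevic_pressure A (abelianization G) (\<lambda>x. ab_proj G (psi x)) f"
  unfolding gurevic_pressure_abelianization unfolding gurevic_pressure_def
proof (rule Limsup_mono, rule eventually_sequentiallyI[of 1])
  fix n :: nat assume n: "1 \<le> n"
  let ?Z = "\<Sum>x \<in> {x \<in> sft A. shiftn n x = x \<and> cocycle G psi n x = \<one>}. exp (birkhoff f n x)"
  let ?Zab = "\<Sum>x \<in> {x \<in> sft A. shiftn n x = x \<and> cocycle G psi n x \<in> derived G (carrier G)}.
      exp (birkhoff f n x)"
  have "\<one> \<in> derived G (carrier G)"
    by (rule subgroup.one_closed[OF derived_is_subgroup]) simp
  then have le: "?Z \<le> ?Zab"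
    by (intro sum_mono2) (auto intro: finite_subset[OF _ finite_periodic[OF n]])
  have "?Z \<ge> 0" by (intro sum_nonneg) simp
  then show "(let Z = ?Z in if Z = 0 then -\<infinity> else ereal (ln Z / real n))
      \<le> (let Z = ?Zab in if Z = 0 then -\<infinity> else ereal (ln Z / real n))"
    using le n by (auto simp: Let_def divide_right_mono)
qed

lemma gurevic_pressure_abelianization_le:
  assumes am: "amenable G" "countable (carrier G)"
  shows "gurevic_pressure A (abelianization G) (\<lambda>x. ab_proj G (psi x)) f \<le> gurevic_pressure A G psi f"
\<comment> \<open>It suffices to bound by every \<open>e\<close> above the pressure. Only real
  \<open>e\<close> needs work: \<open>\<infinity>\<close> is trivial and \<open>-\<infinity>\<close>
  lies above nothing.\<close>
proof (rule dense_ge)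
  fix e assume "gurevic_pressure A G psi f < e"
  then show "gurevic_pressure A (abelianization G) (\<lambda>x. ab_proj G (psi x)) f \<le> e"
  proof (cases e)
    case (real s)
    with \<open>gurevic_pressure A G psi f < e\<close> have s: "gurevic_pressure A G psi f < ereal s" by simp
    \<comment> \<open>One factor counts the initial symbols, the other is the uniform constant for
      each of them; \<open>ln c / n\<close> vanishes in the limit.\<close>
    define c where "c = real CARD('a) * exp (2 * C)"
    have c: "c > 0" by (simp add: c_def)
    let ?S = "\<lambda>n. {x \<in> sft A. shiftn n x = x \<and> cocycle G psi n x \<in> derived G (carrier G)}"
    let ?L = "\<lambda>n a. {x \<in> periodic_at A n a. cocycle G psi n x \<in> derived G (carrier G)}"
    let ?Zab = "\<lambda>n. \<Sum>x \<in> ?S n. exp (birkhoff f n x)"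
    have bound: "?Zab n \<le> c * exp (s * n)" if n: "n \<ge> 1" for n
    proof -
      have finL: "\<forall>a. finite (?L n a)"
        using finite_periodic_at[OF n, of A] by simp
      have "?S n = (\<Union>a. ?L n a)" by (auto simp: periodic_at_def)
      then have "?Zab n = (\<Sum>a\<in>UNIV. \<Sum>x\<in>?L n a. exp (birkhoff f n x))"
        using finL by (simp only:) (subst sum.UNION_disjoint; auto simp: periodic_at_def)
      also have "\<dots> \<le> real CARD('a) * (exp (2 * C) * exp (s * n))"
        by (rule sum_bounded_above) (rule derived_periodic_sum_le[OF am s n])
      finally show ?thesis by (simp add: c_def)
    qed
    have "gurevic_pressure A (abelianization G) (\<lambda>x. ab_proj G (psi x)) f
        \<le> limsup (\<lambda>n. ereal (ln c / real n + s))"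
      unfolding gurevic_pressure_abelianization Let_def
    proof (rule Limsup_mono, rule eventually_sequentiallyI[of 1])
      fix n :: nat assume n: "1 \<le> n"
      have nn: "?Zab n \<ge> 0" by (intro sum_nonneg) simp
      show "(if ?Zab n = 0 then -\<infinity> else ereal (ln (?Zab n) / real n)) \<le> ereal (ln c / real n + s)"
      proof (cases "?Zab n = 0")
        case False
        then have "ln (?Zab n) \<le> ln (c * exp (s * n))"
          using nn bound[OF n] c by (intro ln_mono) auto
        also have "\<dots> = ln c + s * n" using c by (simp add: ln_mult)
        finally show ?thesis using False n by (simp add: field_simps)
      qed simp
    qed
    also have "\<dots> = ereal s"
    proof (rule lim_imp_Limsup)
      have "(\<lambda>n. ln c / real n + s) \<longlonglongrightarrow> 0 + s"
        by (intro tendsto_add tendsto_const lim_const_over_n)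
      then show "(\<lambda>n. ereal (ln c / real n + s)) \<longlonglongrightarrow> ereal s" by simp
    qed simp
    finally show ?thesis by (simp add: real)
  qed auto
qed

end

theorem theorem5p1:
  fixes A :: "'a::finite \<Rightarrow> 'a \<Rightarrow> bool"
    and G :: "('g, 'b) monoid_scheme"
    and psi :: "(nat \<Rightarrow> 'a) \<Rightarrow> 'g"
    and f :: "(nat \<Rightarrow> 'a) \<Rightarrow> real"
  assumes "top_mixing A"
    and "group G" and "countable (carrier G)"
    and "\<forall>x \<in> sft A. psi x \<in> carrier G"
    and "\<exists>\<Psi>. \<forall>x \<in> sft A. psi x = \<Psi> (x 0) (x 1)"
    and "skew_transitive A G psi"
    and "holder_cont A f"
    and "amenable G"
  shows "gurevic_pressure A G psi f =
         gurevic_pressure A (abelianization G) (\<lambda>x. ab_proj G (psi x)) f"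
proof -
  obtain C where C: "\<And>n x y. x \<in> sft A \<Longrightarrow> y \<in> sft A \<Longrightarrow> (\<And>i. i \<le> n \<Longrightarrow> x i = y i) \<Longrightarrow>
      \<bar>birkhoff f n x - birkhoff f n y\<bar> \<le> C"
    using holder_bounded_distortion[OF assms(7)] by blast
  obtain \<Psi> where \<Psi>: "\<forall>x \<in> sft A. psi x = \<Psi> (x 0) (x 1)" using assms(5) by blast
  interpret group G by (rule assms(2))
  interpret skew_product G A psi f C
  proof
    show "psi x \<in> carrier G" if "x \<in> sft A" for x
      using assms(4) that by blast
    show "psi x = psi y" if "x \<in> sft A" "y \<in> sft A" "x 0 = y 0" "x 1 = y 1" for x y
      using \<Psi> that by metis
    show "\<bar>birkhoff f n x - birkhoff f n y\<bar> \<le> C"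
      if "x \<in> sft A" "y \<in> sft A" "\<And>i. i \<le> n \<Longrightarrow> x i = y i" for n x y
      using that by (rule C)
    show "skew_transitive A G psi" by (rule assms(6))
  qed
  show ?thesis
    using gurevic_pressure_le_abelianization gurevic_pressure_abelianization_le[OF assms(8,3)]
    by (rule antisym)
qed

end
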